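(* Let $\boldsymbol{G}_t \in \mathbb{R}^{d_{\mathrm{in}} \times d_{\mathrm{out}}}$ be the gradient of the current ($t$-th) task's loss with respect to the base model weight matrix $\boldsymbol{W} \in \mathbb{R}^{d_{\mathrm{in}} \times d_{\mathrm{out}}}$, let $\boldsymbol{W}_p \in \mathbb{R}^{d_{\mathrm{in}} \times p}$ be the principal subspace of the pre-trained parameters (the matrix of the first $p$ left singular vectors of the pre-trained weight matrix), and let $\boldsymbol{M}_{t-1} \in \mathbb{R}^{d_{\mathrm{in}} \times k}$ be the matrix of dominant gradient directions from previous tasks, where the columns of $[\boldsymbol{W}_p, \boldsymbol{M}_{t-1}]$ are orthonormal. Define $$\hat{\boldsymbol{G}}_t = \boldsymbol{G}_t - \boldsymbol{W}_p \boldsymbol{W}_p^\top \boldsymbol{G}_t - \boldsymbol{M}_{t-1}\boldsymbol{M}_{t-1}^\top \boldsymbol{G}_t,$$ let $\hat{\boldsymbol{G}}_t = \boldsymbol{U}\boldsymbol{S}\boldsymbol{V}^\top$ be its singular value decomposition (singular values in non-increasing order), and initialize $\boldsymbol{A}_t = \boldsymbol{U}_{:,1:r}$, the first $r$ columns of $\boldsymbol{U}$ (the top-$r$ left singular vectors of $\hat{\boldsymbol{G}}_t$), where $r$ is the rank parameter. Then this initialization of $\boldsymbol{A}_t$ is the solution to the constrained optimization problem $$\min_{\boldsymbol{A}_t^\top \boldsymbol{A}_t = \boldsymbol{I}} \ \| \boldsymbol{G}_t - \boldsymbol{A}_t\boldsymbol{A}_t^\top \boldsymbol{G}_t \|_F^2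 \quad \text{s.t.} \quad \boldsymbol{W}_p^\top \boldsymbol{A}_t = \boldsymbol{M}_{t-1}^\top \boldsymbol{A}_t = \boldsymbol{0},$$ where the minimization is over $\boldsymbol{A}_t \in \mathbb{R}^{d_{\mathrm{in}} \times r}$.
   Context: $\|\cdot\|_F$ is the Frobenius norm, $\boldsymbol{I}$ is the identity matrix of the appropriate size, and $[\boldsymbol{W}_p, \boldsymbol{M}_{t-1}]$ is the horizontal concatenation of the two matrices. The matrix $\boldsymbol{A}_t \in \mathbb{R}^{d_{\mathrm{in}} \times r}$ is the down-projection matrix of a low-rank update $\boldsymbol{A}_t\boldsymbol{B}_t$ of $\boldsymbol{W}$, with $\boldsymbol{B}_t \in \mathbb{R}^{r \times d_{\mathrm{out}}}$ and rank parameter $r \ll \min(d_{\mathrm{in}}, d_{\mathrm{out}})$; $\boldsymbol{B}_t$ is initialized to $\boldsymbol{0}$. The gradient $\boldsymbol{G}_t$ is taken at the first training step of task $t$. The number $p$ is chosen by an energy threshold, and $\boldsymbol{M}_{t-1}$ accumulates $k$ dominant singular directions from tasks $1,\dots,t-1$, chosen orthogonal to $\boldsymbol{W}_p$ and to the previously stored directions; $\boldsymbol{M}_0$ is the empty matrix, in which case the terms and constraints involving it are absent.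
   Formalization: If r exceeds the rank of Ĝ_t, an SVD may place zero-singular-value columns in the span of [W_p, M_{t-1}], so A_t is infeasible. Proved: every SVD gives a minimizer if r ≤ rank Ĝ_t; some SVD (same S, V) does whenever r + p + k ≤ d_in. "The solution" means a minimizer. *)

theory Defs
  imports Complex_Main "Jordan_Normal_Form.Matrix" "Jordan_Normal_Form.DL_Rank"
begin

definition frobenius_norm :: "real mat \<Rightarrow> real" where
  "frobenius_norm A = sqrt (\<Sum>i<dim_row A. \<Sum>j<dim_col A. (A $$ (i, j))\<^sup>2)"

definition frobenius_inner :: "real mat \<Rightarrow> real mat \<Rightarrow> real" where
  "frobenius_inner A B = (\<Sum>i<dim_row A. \<Sum>j<dim_col A. A $$ (i, j) * B $$ (i, j))"

text \<open>
  The gradient of a scalar function of \<open>m \<times> n\<close> matrices at \<open>W\<close>, i.e. the matrix representing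
  the Frechet derivative with respect to the Frobenius inner product. Matrices of varying
  dimension do not form a normed-space type, so the limit is written out.
\<close>

definition has_gradient_mat :: "nat \<Rightarrow> nat \<Rightarrow> (real mat \<Rightarrow> real) \<Rightarrow> real mat \<Rightarrow> real mat \<Rightarrow> bool" where
  "has_gradient_mat m n L W G \<longleftrightarrow>
     W \<in> carrier_mat m n \<and> G \<in> carrier_mat m n \<and>
     (\<forall>e>0. \<exists>d>0. \<forall>H\<in>carrier_mat m n. frobenius_norm H < d \<longrightarrow>
        \<bar>L (W + H) - L W - frobenius_inner G H\<bar> \<le> e * frobenius_norm H)"

definition hconcat :: "real mat \<Rightarrow> real mat \<Rightarrow> real mat" where
  "hconcat A B = mat_of_cols (dim_row A) (cols A @ cols B)"

definition first_cols :: "nat \<Rightarrow> real mat \<Rightarrow> real mat" where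
  "first_cols r A = mat_of_cols (dim_row A) (take r (cols A))"

definition orthonormal_cols :: "real mat \<Rightarrow> bool" where
  "orthonormal_cols A \<longleftrightarrow> A\<^sup>T * A = 1\<^sub>m (dim_col A)"

text \<open>
  Full singular value decomposition \<open>A = U S V\<^sup>T\<close>: \<open>U\<close> and \<open>V\<close> are square orthogonal matrices
  and \<open>S\<close> is rectangular diagonal with nonnegative, non-increasing diagonal.
\<close>

definition is_svd :: "nat \<Rightarrow> nat \<Rightarrow> real mat \<Rightarrow> real mat \<Rightarrow> real mat \<Rightarrow> real mat \<Rightarrow> bool" where
  "is_svd m n A U S V \<longleftrightarrow>
     U \<in> carrier_mat m m \<and> S \<in> carrier_mat m n \<and> V \<in> carrier_mat n n \<and>
     orthonormal_cols U \<and> orthonormal_cols V \<and>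
     diagonal_mat S \<and>
     (\<forall>i < min m n. 0 \<le> S $$ (i, i)) \<and>
     (\<forall>i j. i \<le> j \<longrightarrow> j < min m n \<longrightarrow> S $$ (j, j) \<le> S $$ (i, i)) \<and>
     A = U * S * V\<^sup>T"

text \<open>
  If \<open>M\<close> has no columns, the constraint involving it holds trivially.
\<close>

definition feasible :: "nat \<Rightarrow> nat \<Rightarrow> real mat \<Rightarrow> real mat \<Rightarrow> real mat set" where
  "feasible m r Wp M =
     {A \<in> carrier_mat m r. A\<^sup>T * A = 1\<^sub>m r \<and>
        Wp\<^sup>T * A = 0\<^sub>m (dim_col Wp) r \<and> M\<^sup>T * A = 0\<^sub>m (dim_col M) r}"

definition projection_error :: "real mat \<Rightarrow> real mat \<Rightarrow> real" where
  "projection_error G A = (frobenius_norm (G - A * A\<^sup>T * G))\<^sup>2"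

end

theory Submission
  imports Defs
begin

text \<open>
  For feasible \<open>A\<close> the error is \<open>|G|\<^sup>2 - |A\<^sup>T G|\<^sup>2\<close> (Frobenius norms), and the constraints give
  \<open>A\<^sup>T G = A\<^sup>T Ghat\<close>. With \<open>Q = A\<^sup>T U\<close>, which has orthonormal rows, \<open>|A\<^sup>T Ghat|\<^sup>2 = |Q S|\<^sup>2\<close> is the
  sum of the squared singular values weighted by the squared column norms of \<open>Q\<close>. These weights lie
  in \<open>[0, 1]\<close> and sum to \<open>r\<close>, so the sum is at most that of the \<open>r\<close> largest squared singular values,
  which the first \<open>r\<close> columns of \<open>U\<close> attain. Columns of \<open>U\<close> with nonzero singular value lie in
  the column space of \<open>Ghat\<close> and hence satisfy the constraints; the others can be rechosen.
\<close>

section \<open>Frobenius norm, Gram matrices and the projection error\<close>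

lemma mult_mat_index_sum:
  fixes A B :: "real mat"
  assumes "A \<in> carrier_mat m n" "B \<in> carrier_mat n l" "i < m" "j < l"
  shows "(A * B) $$ (i, j) = (\<Sum>k<n. A $$ (i, k) * B $$ (k, j))"
  using assms by (simp add: scalar_prod_def atLeast0LessThan)

lemma frobenius_norm_sq:
  "(frobenius_norm A)\<^sup>2 = (\<Sum>i<dim_row A. \<Sum>j<dim_col A. (A $$ (i, j))\<^sup>2)"
  unfolding frobenius_norm_def by (simp add: sum_nonneg)

text \<open>Diagonal entries of a Gram matrix are squared column lengths, so the norm identities
  below reduce to matrix algebra on \<open>A\<^sup>T * A\<close>.\<close>

lemma frobenius_norm_sq_gram:
  "(frobenius_norm A)\<^sup>2 = (\<Sum>j<dim_col A. (A\<^sup>T * A) $$ (j, j))"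
proof -
  have "(A\<^sup>T * A) $$ (j, j) = (\<Sum>i<dim_row A. (A $$ (i, j))\<^sup>2)" if "j < dim_col A" for j
    using that
    by (subst mult_mat_index_sum[of _ "dim_col A" "dim_row A" _ "dim_col A"])
      (auto simp: power2_eq_square)
  then show ?thesis
    unfolding frobenius_norm_sq by (subst sum.swap) simp
qed

lemma frobenius_norm_transpose: "frobenius_norm A\<^sup>T = frobenius_norm A"
  unfolding frobenius_norm_def by (subst sum.swap) simp

text \<open>\<open>V\<^sup>T * V\<close> cancels inside
  \<open>(A * V\<^sup>T) * (A * V\<^sup>T)\<^sup>T\<close>, so the Gram matrices of the transposes
  agree; the norms are therefore compared on transposes.\<close>

lemma frobenius_norm_mult_orthogonal:
  assumes "A \<in> carrier_mat m n" "V \<in> carrier_mat n n" "orthonormal_cols V"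
  shows "frobenius_norm (A * V\<^sup>T) = frobenius_norm A"
proof -
  have VV: "V\<^sup>T * V = 1\<^sub>m n"
    using assms by (simp add: orthonormal_cols_def)
  have "(A * V\<^sup>T) * (A * V\<^sup>T)\<^sup>T = (A * V\<^sup>T) * (V * A\<^sup>T)"
    using assms by (simp add: transpose_mult[of _ m n _ n])
  also have "\<dots> = A * (V\<^sup>T * (V * A\<^sup>T))"
    using assms by (intro assoc_mult_mat) auto
  also have "V\<^sup>T * (V * A\<^sup>T) = (V\<^sup>T * V) * A\<^sup>T"
    using assms by (intro assoc_mult_mat[symmetric]) auto
  finally have "(A * V\<^sup>T) * (A * V\<^sup>T)\<^sup>T = A * A\<^sup>T"
    using assms VV by simp
  then have "(frobenius_norm (A * V\<^sup>T)\<^sup>T)\<^sup>2 = (frobenius_norm A\<^sup>T)\<^sup>2"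
    unfolding frobenius_norm_sq_gram using assms by simp
  then show ?thesis
    unfolding frobenius_norm_transpose
    by (simp add: frobenius_norm_def sum_nonneg)
qed

text \<open>Pythagoras: the residual \<open>X\<close> is orthogonal to the columns of
  \<open>A\<close>, so \<open>X\<^sup>T * X\<close> reduces to \<open>G\<^sup>T * X\<close>, which
  is \<open>G\<^sup>T * G - Y\<^sup>T * Y\<close>.\<close>

lemma projection_error_eq:
  assumes A: "A \<in> carrier_mat m r" "A\<^sup>T * A = 1\<^sub>m r" and G: "G \<in> carrier_mat m n"
  shows "projection_error G A = (frobenius_norm G)\<^sup>2 - (frobenius_norm (A\<^sup>T * G))\<^sup>2"
proof -
  define Y where "Y = A\<^sup>T * G"
  have Y: "Y \<in> carrier_mat r n" using A G by (simp add: Y_def)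
  have YT: "Y\<^sup>T = G\<^sup>T * A"
    unfolding Y_def using A G by (simp add: transpose_mult[of _ r m _ n])
  define X where "X = G - A * Y"
  have X: "X \<in> carrier_mat m n" using A G Y by (simp add: X_def minus_carrier_mat)
  have AX: "A\<^sup>T * X = 0\<^sub>m r n"
  proof -
    have "A\<^sup>T * X = A\<^sup>T * G - A\<^sup>T * (A * Y)"
      unfolding X_def using A G Y by (intro mult_minus_distrib_mat) auto
    also have "A\<^sup>T * (A * Y) = (A\<^sup>T * A) * Y"
      using A Y by (intro assoc_mult_mat[symmetric]) auto
    finally show ?thesis using A(2) Y by (simp add: Y_def[symmetric])
  qed
  have XT: "X\<^sup>T = G\<^sup>T - Y\<^sup>T * A\<^sup>T"
    unfolding X_def using A G Y
    by (simp add: transpose_minus[of _ m n] transpose_mult[of _ m r _ n])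
  have "X\<^sup>T * X = G\<^sup>T * X - (Y\<^sup>T * A\<^sup>T) * X"
    unfolding XT using A G Y X by (intro minus_mult_distrib_mat) auto
  also have "(Y\<^sup>T * A\<^sup>T) * X = Y\<^sup>T * (A\<^sup>T * X)"
    using A Y X by (intro assoc_mult_mat) auto
  also have "G\<^sup>T * X = G\<^sup>T * G - G\<^sup>T * (A * Y)"
    unfolding X_def using A G Y by (intro mult_minus_distrib_mat) auto
  also have "G\<^sup>T * (A * Y) = Y\<^sup>T * Y"
    unfolding YT using A G Y by (intro assoc_mult_mat[symmetric]) auto
  finally have gram: "X\<^sup>T * X = G\<^sup>T * G - Y\<^sup>T * Y"
    unfolding AX using Y G by auto
  have "A * A\<^sup>T * G = A * Y"
    unfolding Y_def using A G by (intro assoc_mult_mat) auto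
  then have "projection_error G A = (frobenius_norm X)\<^sup>2"
    by (simp add: projection_error_def X_def)
  also have "\<dots> = (frobenius_norm G)\<^sup>2 - (frobenius_norm Y)\<^sup>2"
    unfolding frobenius_norm_sq_gram gram using G X Y by (simp add: sum_subtractf)
  finally show ?thesis by (simp add: Y_def)
qed

section \<open>Weighted sums of squared singular values\<close>

text \<open>Any \<open>t\<close> separating the first \<open>r\<close> weights from the others gives
  \<open>f j * c j \<le> t * c j + (f j - t)\<close> for \<open>j < r\<close> and \<open>f j * c j \<le> t * c j\<close> for \<open>j \<ge> r\<close>.\<close>

lemma weighted_sum_le_sum_first:
  fixes f c :: "nat \<Rightarrow> real"
  assumes "r \<le> N"
    and f: "\<And>i. i < N \<Longrightarrow> 0 \<le> f i" "\<And>i j. i \<le> j \<Longrightarrow> j < N \<Longrightarrow> f j \<le> f i"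
    and c: "\<And>i. i < N \<Longrightarrow> 0 \<le> c i" "\<And>i. i < N \<Longrightarrow> c i \<le> 1" "(\<Sum>i<N. c i) \<le> real r"
  shows "(\<Sum>i<N. f i * c i) \<le> (\<Sum>i<r. f i)"
proof -
  \<comment> \<open>The threshold is the first value left out of the sum; when \<open>r = N\<close>
    nothing is left out and 0, a lower bound of \<open>f\<close>, serves.\<close>
  define t where "t = (if r < N then f r else 0)"
  have t: "0 \<le> t" "\<And>i. i < r \<Longrightarrow> t \<le> f i" "\<And>i. r \<le> i \<Longrightarrow> i < N \<Longrightarrow> f i \<le> t"
    using assms by (auto simp: t_def)
  have "f i * c i \<le> t * c i + (if i < r then f i - t else 0)" if "i < N" for i
  proof (cases "i < r")
    case True
    then have "(f i - t) * c i \<le> (f i - t) * 1"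
      using t c that by (intro mult_left_mono) auto
    then show ?thesis using True by (simp add: algebra_simps)
  next
    case False
    then show ?thesis using t c that by (simp add: mult_right_mono)
  qed
  then have "(\<Sum>i<N. f i * c i) \<le> (\<Sum>i<N. t * c i + (if i < r then f i - t else 0))"
    by (intro sum_mono) simp
  also have "\<dots> = t * (\<Sum>i<N. c i) + (\<Sum>i<N. if i < r then f i - t else 0)"
    by (simp add: sum.distrib sum_distrib_left)
  also have "(\<Sum>i<N. if i < r then f i - t else 0) = (\<Sum>i<r. f i - t)"
    using \<open>r \<le> N\<close> by (intro sum.mono_neutral_cong_right) auto
  \<comment> \<open>Nonnegativity of \<open>t\<close> lets the bound on the total of
    \<open>c\<close> enter; \<open>t * real r\<close> then cancels against the sum of
    \<open>f i - t\<close>.\<close>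
  also have "t * (\<Sum>i<N. c i) \<le> t * real r"
    using t c by (intro mult_left_mono) auto
  finally show ?thesis by (simp add: sum_subtractf)
qed

lemma orthogonal_mat_inverse:
  assumes "U \<in> carrier_mat m m" "orthonormal_cols U"
  shows "U\<^sup>T * U = 1\<^sub>m m" "U * U\<^sup>T = 1\<^sub>m m"
proof -
  show *: "U\<^sup>T * U = 1\<^sub>m m" using assms by (simp add: orthonormal_cols_def)
  show "U * U\<^sup>T = 1\<^sub>m m"
    using assms by (intro mat_mult_left_right_inverse[OF _ _ *]) auto
qed

text \<open>\<open>S\<close> is rectangular: for \<open>n > m\<close> its columns from
  \<open>m\<close> on have no diagonal entry and are zero, hence the case distinction.\<close>

lemma mult_diagonal_index:
  fixes Q S :: "real mat"
  assumes "Q \<in> carrier_mat l m" "S \<in> carrier_mat m n" "diagonal_mat S" "i < l" "j < n"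
  shows "(Q * S) $$ (i, j) = (if j < m then Q $$ (i, j) * S $$ (j, j) else 0)"
proof -
  have "(Q * S) $$ (i, j) = (\<Sum>k<m. Q $$ (i, k) * S $$ (k, j))"
    using assms by (intro mult_mat_index_sum)
  also have "\<dots> = (\<Sum>k<m. if k = j then Q $$ (i, j) * S $$ (j, j) else 0)"
    using assms by (intro sum.cong) (auto simp: diagonal_mat_def)
  finally show ?thesis by simp
qed

lemma frobenius_norm_sq_mult_diagonal:
  fixes Q S :: "real mat"
  assumes Q: "Q \<in> carrier_mat r m" and S: "S \<in> carrier_mat m n" "diagonal_mat S"
  shows "(frobenius_norm (Q * S))\<^sup>2 =
    (\<Sum>j<min m n. (S $$ (j, j))\<^sup>2 * (\<Sum>i<r. (Q $$ (i, j))\<^sup>2))"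
proof -
  have "(frobenius_norm (Q * S))\<^sup>2 = (\<Sum>i<r. \<Sum>j<n. ((Q * S) $$ (i, j))\<^sup>2)"
    unfolding frobenius_norm_sq using Q S by simp
  also have "\<dots> = (\<Sum>i<r. \<Sum>j<min m n. (S $$ (j, j))\<^sup>2 * (Q $$ (i, j))\<^sup>2)"
  proof (rule sum.cong[OF refl])
    fix i assume "i \<in> {..<r}"
    then show "(\<Sum>j<n. ((Q * S) $$ (i, j))\<^sup>2) = (\<Sum>j<min m n. (S $$ (j, j))\<^sup>2 * (Q $$ (i, j))\<^sup>2)"
      by (intro sum.mono_neutral_cong_right)
        (auto simp: mult_diagonal_index[OF Q S] power_mult_distrib)
  qed
  also have "\<dots> = (\<Sum>j<min m n. (S $$ (j, j))\<^sup>2 * (\<Sum>i<r. (Q $$ (i, j))\<^sup>2))"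
    by (subst sum.swap) (simp add: sum_distrib_left)
  finally show ?thesis .
qed

text \<open>The total is the trace of \<open>Q * Q\<^sup>T\<close>. For a single column,
  \<open>E = Q\<^sup>T * Q\<close> is symmetric and idempotent, so \<open>E $$ (j, j)\<close> is the
  sum of squares of row \<open>j\<close> of \<open>E\<close> and dominates its own square.\<close>

lemma orthonormal_rows_sum_squares:
  fixes Q :: "real mat"
  assumes Q: "Q \<in> carrier_mat r m" "Q * Q\<^sup>T = 1\<^sub>m r"
  shows "(\<Sum>j<m. \<Sum>i<r. (Q $$ (i, j))\<^sup>2) = real r"
    and "j < m \<Longrightarrow> (\<Sum>i<r. (Q $$ (i, j))\<^sup>2) \<le> 1"
proof -
  have "(frobenius_norm Q\<^sup>T)\<^sup>2 = real r"
    unfolding frobenius_norm_sq_gram using Q by simp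
  then show "(\<Sum>j<m. \<Sum>i<r. (Q $$ (i, j))\<^sup>2) = real r"
    unfolding frobenius_norm_transpose frobenius_norm_sq using Q
    by (subst sum.swap) simp
next
  assume j: "j < m"
  define E where "E = Q\<^sup>T * Q"
  have E: "E \<in> carrier_mat m m" using Q by (simp add: E_def)
  have ET: "E\<^sup>T = E" unfolding E_def using Q by (simp add: transpose_mult[of _ m r _ m])
  have "E * E = Q\<^sup>T * (Q * (Q\<^sup>T * Q))"
    unfolding E_def using Q by (intro assoc_mult_mat) auto
  also have "Q * (Q\<^sup>T * Q) = (Q * Q\<^sup>T) * Q"
    using Q by (intro assoc_mult_mat[symmetric]) auto
  finally have EE: "E * E = E" using Q by (simp add: E_def)
  have sym: "E $$ (k, j) = E $$ (j, k)" if "k < m" for k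
    using arg_cong[OF ET, of "\<lambda>M. M $$ (j, k)"] E that j by simp
  have "E $$ (j, j) = (E * E) $$ (j, j)" by (simp add: EE)
  also have "\<dots> = (\<Sum>k<m. (E $$ (j, k))\<^sup>2)"
    using E j by (subst mult_mat_index_sum[of _ m m _ m]) (auto simp: sym power2_eq_square)
  also have "\<dots> \<ge> (E $$ (j, j))\<^sup>2"
    using j by (intro member_le_sum) auto
  finally have "E $$ (j, j) * E $$ (j, j) \<le> E $$ (j, j) * 1" by (simp add: power2_eq_square)
  then have "E $$ (j, j) \<le> 1"
    by (cases "E $$ (j, j) > 0") auto
  moreover have "E $$ (j, j) = (\<Sum>i<r. (Q $$ (i, j))\<^sup>2)"
    unfolding E_def using Q j
    by (subst mult_mat_index_sum[of _ m r _ m]) (auto simp: power2_eq_square)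
  ultimately show "(\<Sum>i<r. (Q $$ (i, j))\<^sup>2) \<le> 1" by simp
qed

lemma is_svdD:
  assumes "is_svd m n X U S V"
  shows "U \<in> carrier_mat m m" "S \<in> carrier_mat m n" "V \<in> carrier_mat n n"
    "orthonormal_cols U" "orthonormal_cols V" "diagonal_mat S"
    "\<And>i. i < min m n \<Longrightarrow> 0 \<le> S $$ (i, i)"
    "\<And>i j. i \<le> j \<Longrightarrow> j < min m n \<Longrightarrow> S $$ (j, j) \<le> S $$ (i, i)"
    "X = U * S * V\<^sup>T"
  using assms unfolding is_svd_def by auto

text \<open>\<open>V\<^sup>T\<close> drops out by orthogonal invariance; the right factor left over
  is diagonal, so the norm can be computed column by column.\<close>

lemma frobenius_norm_mult_svd:
  assumes svd: "is_svd m n X U S V" and B: "B \<in> carrier_mat l m"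
  shows "frobenius_norm (B * X) = frobenius_norm (B * U * S)"
proof -
  note D = is_svdD[OF svd]
  have "B * X = (B * (U * S)) * V\<^sup>T"
    unfolding D(9) using D(1-3) B by (intro assoc_mult_mat[symmetric]) auto
  also have "B * (U * S) = B * U * S"
    using D(1,2) B by (intro assoc_mult_mat[symmetric]) auto
  finally show ?thesis
    using D B by (simp add: frobenius_norm_mult_orthogonal[of _ l n])
qed

lemma frobenius_norm_sq_mult_svd_le:
  assumes svd: "is_svd m n X U S V" and A: "A \<in> carrier_mat m r" "A\<^sup>T * A = 1\<^sub>m r"
    and r: "r \<le> min m n"
  shows "(frobenius_norm (A\<^sup>T * X))\<^sup>2 \<le> (\<Sum>i<r. (S $$ (i, i))\<^sup>2)"
proof -
  note D = is_svdD[OF svd]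
  define Q where "Q = A\<^sup>T * U"
  have Q: "Q \<in> carrier_mat r m" using A D by (simp add: Q_def)
  have "Q * Q\<^sup>T = (A\<^sup>T * U) * (U\<^sup>T * A)"
    unfolding Q_def using A D by (simp add: transpose_mult[of _ r m _ m])
  also have "\<dots> = A\<^sup>T * (U * (U\<^sup>T * A))"
    using A D by (intro assoc_mult_mat) auto
  also have "U * (U\<^sup>T * A) = (U * U\<^sup>T) * A"
    using A D by (intro assoc_mult_mat[symmetric]) auto
  finally have QQ: "Q * Q\<^sup>T = 1\<^sub>m r"
    using A orthogonal_mat_inverse(2)[OF D(1,4)] by simp
  \<comment> \<open>Columns of \<open>Q\<close> beyond \<open>min m n\<close> meet no singular value
    and are dropped, so the remaining weights sum to at most \<open>r\<close> rather than exactly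
    \<open>r\<close>.\<close>
  have "(\<Sum>j<min m n. \<Sum>i<r. (Q $$ (i, j))\<^sup>2) \<le> (\<Sum>j<m. \<Sum>i<r. (Q $$ (i, j))\<^sup>2)"
    by (intro sum_mono2) (auto intro: sum_nonneg)
  then have "(\<Sum>j<min m n. \<Sum>i<r. (Q $$ (i, j))\<^sup>2) \<le> real r"
    using orthonormal_rows_sum_squares(1)[OF Q QQ] by simp
  then have "(\<Sum>j<min m n. (S $$ (j, j))\<^sup>2 * (\<Sum>i<r. (Q $$ (i, j))\<^sup>2)) \<le> (\<Sum>i<r. (S $$ (i, i))\<^sup>2)"
    using r orthonormal_rows_sum_squares(2)[OF Q QQ] D(7,8)
    by (intro weighted_sum_le_sum_first) (auto intro: sum_nonneg power_mono)
  then show ?thesis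
    using frobenius_norm_mult_svd[OF svd, of "A\<^sup>T" r] A
      frobenius_norm_sq_mult_diagonal[OF Q D(2,6)]
    by (simp add: Q_def)
qed

section \<open>Leading columns of a matrix\<close>

lemma first_cols_carrier:
  assumes "U \<in> carrier_mat m l" "r \<le> l"
  shows "first_cols r U \<in> carrier_mat m r"
  using assms mat_of_cols_carrier(1)[of m "take r (cols U)"] by (simp add: first_cols_def min_absorb2)

lemma col_first_cols:
  assumes "U \<in> carrier_mat m l" "r \<le> l" "j < r"
  shows "col (first_cols r U) j = col U j"
  using assms unfolding first_cols_def by (subst col_mat_of_cols) auto

lemma mult_first_cols_index:
  assumes "U \<in> carrier_mat m l" "r \<le> l" "j < r" "B \<in> carrier_mat q m" "i < q"
  shows "(B * first_cols r U) $$ (i, j) = (B * U) $$ (i, j)"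
  using assms first_cols_carrier[OF assms(1,2)] col_first_cols[OF assms(1-3)] by simp

lemma orthonormal_cols_iff:
  "orthonormal_cols A \<longleftrightarrow>
    (\<forall>i<dim_col A. \<forall>j<dim_col A. col A i \<bullet> col A j = (if i = j then 1 else 0))"
  unfolding orthonormal_cols_def mat_eq_iff by auto

lemma orthonormal_first_cols:
  assumes "U \<in> carrier_mat m l" "r \<le> l" "orthonormal_cols U"
  shows "orthonormal_cols (first_cols r U)"
  using assms first_cols_carrier[OF assms(1,2)]
  unfolding orthonormal_cols_iff by (auto simp: col_first_cols)

section \<open>Optimality of the leading left singular vectors\<close>

lemma frobenius_norm_sq_first_cols_svd:
  assumes svd: "is_svd m n X U S V" and r: "r \<le> min m n"
  shows "(frobenius_norm ((first_cols r U)\<^sup>T * X))\<^sup>2 = (\<Sum>i<r. (S $$ (i, i))\<^sup>2)"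
proof -
  note D = is_svdD[OF svd]
  define A where "A = first_cols r U"
  have A: "A \<in> carrier_mat m r" using D r by (simp add: A_def first_cols_carrier)
  define Q where "Q = A\<^sup>T * U"
  have Q: "Q \<in> carrier_mat r m" using A D by (simp add: Q_def)
  \<comment> \<open>\<open>Q\<close> consists of the top \<open>r\<close> rows of the identity, so
    each of the first \<open>r\<close> singular values gets weight 1 and the others 0: the bound of
    \<open>frobenius_norm_sq_mult_svd_le\<close> is attained.\<close>
  have Qij: "Q $$ (i, j) = (if i = j then 1 else 0)" if "i < r" "j < m" for i j
    using that D(1,4) r A unfolding orthonormal_cols_iff
    by (simp add: Q_def) (simp add: A_def col_first_cols[of U m m])
  have "(\<Sum>i<r. (Q $$ (i, j))\<^sup>2) = (if j < r then 1 else 0)" if "j < m" for j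
  proof -
    have "(\<Sum>i<r. (Q $$ (i, j))\<^sup>2) = (\<Sum>i<r. if i = j then 1 else 0)"
      using that by (intro sum.cong) (auto simp: Qij)
    then show ?thesis by simp
  qed
  then have "(frobenius_norm (Q * S))\<^sup>2 = (\<Sum>j<min m n. (S $$ (j, j))\<^sup>2 * (if j < r then 1 else 0))"
    unfolding frobenius_norm_sq_mult_diagonal[OF Q D(2,6)] by simp
  also have "\<dots> = (\<Sum>j<r. (S $$ (j, j))\<^sup>2)"
    using r by (intro sum.mono_neutral_cong_right) auto
  finally show ?thesis
    using frobenius_norm_mult_svd[OF svd, of "A\<^sup>T" r] A by (simp add: Q_def A_def)
qed

text \<open>Stated for any decomposition of \<open>X\<close> whose leading columns meet the
  constraints, so that it serves both the given \<open>U\<close> and a rechosen one.\<close>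

lemma first_cols_arg_min:
  assumes G: "G \<in> carrier_mat m n" and Wp: "Wp \<in> carrier_mat m p" and M: "M \<in> carrier_mat m k"
    and X: "X = G - Wp * Wp\<^sup>T * G - M * M\<^sup>T * G"
    and svd: "is_svd m n X U S V" and r: "r \<le> min m n"
    and orth: "Wp\<^sup>T * first_cols r U = 0\<^sub>m p r" "M\<^sup>T * first_cols r U = 0\<^sub>m k r"
  shows "is_arg_min (projection_error G) (\<lambda>A. A \<in> feasible m r Wp M) (first_cols r U)"
proof -
  note D = is_svdD[OF svd]
  have U: "first_cols r U \<in> carrier_mat m r" using D r by (simp add: first_cols_carrier)
  have "orthonormal_cols (first_cols r U)"
    using D r by (intro orthonormal_first_cols) auto
  then have feas: "first_cols r U \<in> feasible m r Wp M"
    using U orth Wp M by (simp add: feasible_def orthonormal_cols_def)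
  \<comment> \<open>Each constraint on \<open>A\<close> removes one projection term from
    \<open>A\<^sup>T * X\<close>; this is used with \<open>Wp\<close> and with
    \<open>M\<close>.\<close>
  have kill: "A\<^sup>T * (B * B\<^sup>T * G) = 0\<^sub>m r n"
    if A: "A \<in> carrier_mat m r" and B: "B \<in> carrier_mat m q" and BA: "B\<^sup>T * A = 0\<^sub>m q r" for A B q
  proof -
    have "A\<^sup>T * B = (B\<^sup>T * A)\<^sup>T" using A B by (simp add: transpose_mult[of _ q m _ r])
    then have AB: "A\<^sup>T * B = 0\<^sub>m r q" by (simp add: BA)
    have "B * B\<^sup>T * G = B * (B\<^sup>T * G)" using B G by (intro assoc_mult_mat) auto
    moreover have "A\<^sup>T * (B * (B\<^sup>T * G)) = (A\<^sup>T * B) * (B\<^sup>T * G)"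
      using A B G by (intro assoc_mult_mat[symmetric]) auto
    ultimately show ?thesis using AB B G by simp
  qed
  have err: "projection_error G A = (frobenius_norm G)\<^sup>2 - (frobenius_norm (A\<^sup>T * X))\<^sup>2"
    if "A \<in> feasible m r Wp M" for A
  proof -
    have A: "A \<in> carrier_mat m r" "A\<^sup>T * A = 1\<^sub>m r"
      "Wp\<^sup>T * A = 0\<^sub>m p r" "M\<^sup>T * A = 0\<^sub>m k r"
      using that Wp M by (auto simp: feasible_def)
    have "A\<^sup>T * X = A\<^sup>T * (G - Wp * Wp\<^sup>T * G) - A\<^sup>T * (M * M\<^sup>T * G)"
      unfolding X using A G Wp M by (intro mult_minus_distrib_mat) (auto intro: minus_carrier_mat)
    also have "A\<^sup>T * (G - Wp * Wp\<^sup>T * G) = A\<^sup>T * G - A\<^sup>T * (Wp * Wp\<^sup>T * G)"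
      using A G Wp by (intro mult_minus_distrib_mat) auto
    finally have "A\<^sup>T * X = A\<^sup>T * G"
      using kill[OF A(1) Wp A(3)] kill[OF A(1) M A(4)] A(1) G by auto
    then show ?thesis using projection_error_eq[OF A(1,2) G] by simp
  qed
  have "projection_error G (first_cols r U) \<le> projection_error G A"
    if "A \<in> feasible m r Wp M" for A
    using err[OF that] err[OF feas] frobenius_norm_sq_first_cols_svd[OF svd r]
      frobenius_norm_sq_mult_svd_le[OF svd, of A r] that r
    by (simp add: feasible_def)
  then show ?thesis
    using feas by (force simp: is_arg_min_def)
qed

section \<open>Nonzero singular values and rank\<close>

text \<open>\<open>B * U * S\<close> has norm zero, so all its entries vanish; the entry at
  \<open>(i, j)\<close> is that of \<open>B * U\<close> times a nonzero singular value. With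
  \<open>B\<close> the transposed constraint matrix, the matching columns of \<open>U\<close>
  satisfy the constraints.\<close>

lemma left_singular_vector_orthogonal:
  assumes svd: "is_svd m n X U S V" and B: "B \<in> carrier_mat q m" and BX: "B * X = 0\<^sub>m q n"
    and "i < q" "j < min m n" "S $$ (j, j) \<noteq> 0"
  shows "(B * U) $$ (i, j) = 0"
proof -
  note D = is_svdD[OF svd]
  have BU: "B * U \<in> carrier_mat q m" using B D by simp
  have "(frobenius_norm (B * U * S))\<^sup>2 = 0"
    unfolding frobenius_norm_mult_svd[OF svd B, symmetric] BX by (simp add: frobenius_norm_sq)
  then have "(\<Sum>a<q. \<Sum>b<n. ((B * U * S) $$ (a, b))\<^sup>2) = 0"
    unfolding frobenius_norm_sq using B D by (simp del: index_mult_mat(1))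
  then have "((B * U * S) $$ (i, j))\<^sup>2 = 0"
    using assms by (simp add: sum_nonneg_eq_0_iff sum_nonneg)
  then show ?thesis
    using mult_diagonal_index[OF BU D(2,6)] assms by simp
qed

text \<open>Induction on \<open>d\<close>: each summand is an outer product of rank at most 1, and
  rank is subadditive.\<close>

lemma (in vec_space) rank_sum_product_le:
  fixes f g :: "nat \<Rightarrow> nat \<Rightarrow> 'a"
  shows "rank (mat n nc (\<lambda>(i, j). \<Sum>l<d. f l i * g l j)) \<le> d"
proof (induction d)
  case 0
  have "mat n nc (\<lambda>(i, j). \<Sum>l<0. f l i * g l j) = 0\<^sub>m n nc" by auto
  then show ?case by (simp only: rank_0I)
next
  case (Suc d)
  let ?A = "mat n nc (\<lambda>(i, j). \<Sum>l<d. f l i * g l j)"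
  let ?B = "mat n nc (\<lambda>(i, j). f d i * g d j)"
  have "mat n nc (\<lambda>(i, j). \<Sum>l<Suc d. f l i * g l j) = ?A + ?B" by auto
  moreover have "rank (?A + ?B) \<le> rank ?A + rank ?B"
    by (rule rank_subadditive) auto
  moreover have "rank ?B \<le> 1"
    by (rule rank_le_1_product_entries[of _ nc "f d" "g d"]) auto
  ultimately show ?case using Suc by simp
qed

text \<open>If \<open>S $$ (j, j)\<close> vanished, so would all later singular values by
  monotonicity, making \<open>X\<close> a sum of \<open>j\<close> outer products and its rank at
  most \<open>j < r\<close>.\<close>

lemma singular_value_nonzero:
  assumes svd: "is_svd m n X U S V" and "r \<le> min m n" "r \<le> vec_space.rank m X" "j < r"
  shows "S $$ (j, j) \<noteq> 0"
proof
  assume z: "S $$ (j, j) = 0"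
  note D = is_svdD[OF svd]
  have zero: "S $$ (l, l) = 0" if "j \<le> l" "l < min m n" for l
    using D(7)[of l] D(8)[of j l] that z by simp
  have "X = mat m n (\<lambda>(a, b). \<Sum>l<j. (U $$ (a, l) * S $$ (l, l)) * V $$ (b, l))"
  proof (rule eq_matI)
    fix a b assume "a < dim_row (mat m n (\<lambda>(a, b). \<Sum>l<j. (U $$ (a, l) * S $$ (l, l)) * V $$ (b, l)))"
      "b < dim_col (mat m n (\<lambda>(a, b). \<Sum>l<j. (U $$ (a, l) * S $$ (l, l)) * V $$ (b, l)))"
    then have ab: "a < m" "b < n" by auto
    have "X $$ (a, b) = (\<Sum>l<n. (U * S) $$ (a, l) * V\<^sup>T $$ (l, b))"
      unfolding D(9) using D(1-3) ab by (intro mult_mat_index_sum) auto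
    also have "\<dots> = (\<Sum>l<j. (U $$ (a, l) * S $$ (l, l)) * V $$ (b, l))"
      using ab D(3) \<open>j < r\<close> \<open>r \<le> min m n\<close> zero
      by (intro sum.mono_neutral_cong_right)
        (auto simp: mult_diagonal_index[OF D(1,2,6)] not_less)
    finally show "X $$ (a, b) = mat m n (\<lambda>(a, b). \<Sum>l<j. (U $$ (a, l) * S $$ (l, l)) * V $$ (b, l)) $$ (a, b)"
      using ab by simp
  qed (use D in auto)
  then have "vec_space.rank m X \<le> j"
    using vec_space.rank_sum_product_le[of m n "\<lambda>l a. U $$ (a, l) * S $$ (l, l)" "\<lambda>l b. V $$ (b, l)" j]
    by simp
  then show False using assms by simp
qed

section \<open>Orthonormal lists and their completion\<close>

text \<open>Lists turn completing a family into appending. \<open>sorted_wrt\<close> relates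
  distinct positions, so a repeated vector is excluded: its product with its copy would have to be
  both 1 and 0.\<close>

definition orthonormal_list :: "nat \<Rightarrow> real vec list \<Rightarrow> bool" where
  "orthonormal_list m xs \<longleftrightarrow> set xs \<subseteq> carrier_vec m \<and>
    (\<forall>x\<in>set xs. x \<bullet> x = 1) \<and> sorted_wrt (\<lambda>x y. x \<bullet> y = 0) xs"

lemma orthonormal_list_append:
  "orthonormal_list m (xs @ ys) \<longleftrightarrow>
    orthonormal_list m xs \<and> orthonormal_list m ys \<and> (\<forall>x\<in>set xs. \<forall>y\<in>set ys. x \<bullet> y = 0)"
  unfolding orthonormal_list_def sorted_wrt_append by auto

text \<open>The scalar product sums over the dimension of its second argument, so its symmetry has
  to come from the common dimension \<open>m\<close>.\<close>

lemma orthonormal_list_append_commute: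
  "orthonormal_list m (xs @ ys) \<longleftrightarrow> orthonormal_list m (ys @ xs)"
proof -
  have "x \<bullet> y = y \<bullet> x" if "orthonormal_list m xs" "orthonormal_list m ys" "x \<in> set xs" "y \<in> set ys" for x y
    using that by (intro comm_scalar_prod[of _ m]) (auto simp: orthonormal_list_def)
  then show ?thesis unfolding orthonormal_list_append by metis
qed

lemma orthonormal_list_cols:
  assumes "A \<in> carrier_mat m l"
  shows "orthonormal_list m (cols A) \<longleftrightarrow> orthonormal_cols A"
proof
  assume *: "orthonormal_list m (cols A)"
  have lt: "col A i \<bullet> col A j = 0" if "i < j" "j < dim_col A" for i j
    using * that by (auto simp: orthonormal_list_def sorted_wrt_iff_nth_less)
  show "orthonormal_cols A"
    unfolding orthonormal_cols_iff
  proof (intro allI impI)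
    fix i j assume ij: "i < dim_col A" "j < dim_col A"
    have "col A i \<bullet> col A i = 1"
      using * ij by (auto simp: orthonormal_list_def cols_def)
    moreover have "col A i \<bullet> col A j = col A j \<bullet> col A i"
      using assms by (intro comm_scalar_prod[of _ m]) auto
    ultimately show "col A i \<bullet> col A j = (if i = j then 1 else 0)"
      using lt[of i j] lt[of j i] ij by (cases i j rule: linorder_cases) auto
  qed
next
  assume "orthonormal_cols A"
  then show "orthonormal_list m (cols A)"
    using assms cols_dim[of A] unfolding orthonormal_cols_iff
    by (auto simp: orthonormal_list_def sorted_wrt_iff_nth_less cols_def)
qed

text \<open>The first \<open>m\<close> vectors form an orthogonal square matrix \<open>A\<close>. A
  further vector \<open>x\<close> would satisfy \<open>A\<^sup>T *\<^sub>v x = 0\<^sub>v m\<close>,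
  hence be zero because \<open>A * A\<^sup>T\<close> is the identity, against \<open>x\<close>
  having length 1.\<close>

lemma orthonormal_list_length_le:
  assumes "orthonormal_list m xs"
  shows "length xs \<le> m"
proof (rule ccontr)
  assume "\<not> length xs \<le> m"
  then have len: "m < length xs" by simp
  define A where "A = mat_of_cols m (take m xs)"
  have A: "A \<in> carrier_mat m m"
    using mat_of_cols_carrier(1)[of m "take m xs"] len by (simp add: A_def)
  have split: "orthonormal_list m (take m xs @ drop m xs)" using assms by simp
  then have "set (take m xs) \<subseteq> carrier_vec m"
    unfolding orthonormal_list_append unfolding orthonormal_list_def by blast
  then have cA: "cols A = take m xs" unfolding A_def by (rule cols_mat_of_cols)
  then have "orthonormal_cols A"
    using split unfolding orthonormal_list_cols[OF A, symmetric] orthonormal_list_append by simp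
  then have inv: "A * A\<^sup>T = 1\<^sub>m m" using A by (intro orthogonal_mat_inverse)
  define x where "x = xs ! m"
  have x: "x \<in> carrier_vec m" "x \<bullet> x = 1"
    using assms len by (auto simp: orthonormal_list_def x_def)
  have "col A i \<bullet> x = 0" if "i < m" for i
  proof -
    have "col A i = xs ! i" using that A cA by (simp flip: cols_nth)
    then show ?thesis
      using assms that len by (auto simp: orthonormal_list_def x_def sorted_wrt_iff_nth_less)
  qed
  then have "A\<^sup>T *\<^sub>v x = 0\<^sub>v m" using A by (intro eq_vecI) auto
  moreover have "A *\<^sub>v (A\<^sup>T *\<^sub>v x) = (A * A\<^sup>T) *\<^sub>v x"
    using A x by (intro assoc_mult_mat_vec[symmetric]) auto
  ultimately have "x = A *\<^sub>v 0\<^sub>v m" using inv x by simp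
  then have "x = 0\<^sub>v m" using A by auto
  then show False using x(2) by simp
qed

text \<open>The vectors, padded with zero rows, form a singular square matrix; a nonzero kernel
  vector is orthogonal to all of them and only has to be normalized.\<close>

lemma orthonormal_list_extend_one:
  assumes xs: "orthonormal_list m xs" and len: "length xs < m"
  shows "\<exists>y. orthonormal_list m (xs @ [y])"
proof -
  define B where "B = mat_of_rows m (xs @ replicate (m - length xs) (0\<^sub>v m))"
  have sub: "set xs \<subseteq> carrier_vec m" using xs by (simp add: orthonormal_list_def)
  have B: "B \<in> carrier_mat m m" using len by (simp add: B_def mat_of_rows_def)
  \<comment> \<open>As \<open>length xs < m\<close>, the last row is always padding, and one zero
    row makes the determinant vanish.\<close>
  have last: "row B (m - 1) = 0\<^sub>v m"
    unfolding B_def using len by (subst mat_of_rows_row) (auto simp: nth_append)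
  have "B = mat\<^sub>r m m (\<lambda>i. if i = m - 1 then 0\<^sub>v m else row B i)"
    by (rule eq_rowI) (use B last in auto)
  moreover have "det (mat\<^sub>r m m (\<lambda>i. if i = m - 1 then 0\<^sub>v m else row B i)) = 0"
    using B len by (intro det_row_0) auto
  ultimately have "det B = 0" by simp
  then obtain v where v: "v \<in> carrier_vec m" "v \<noteq> 0\<^sub>v m" "B *\<^sub>v v = 0\<^sub>v m"
    using det_0_iff_vec_prod_zero_field[OF B] by auto
  have orth: "x \<bullet> v = 0" if x: "x \<in> set xs" for x
  proof -
    obtain i where i: "i < length xs" "x = xs ! i" using x by (auto simp: in_set_conv_nth)
    have "row B i = x"
      unfolding B_def using i len sub by (subst mat_of_rows_row) (auto simp: nth_append)
    then show ?thesis
      using arg_cong[OF v(3), of "\<lambda>w. w $ i"] i len B by simp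
  qed
  have pos: "v \<bullet> v > 0"
    using conjugate_square_greater_0_vec[OF v(1)] v(2) by simp
  define y where "y = (1 / sqrt (v \<bullet> v)) \<cdot>\<^sub>v v"
  have y: "y \<in> carrier_vec m" using v by (simp add: y_def)
  have "y \<bullet> y = 1"
    using pos v(1) by (simp add: y_def)
  moreover have "x \<bullet> y = 0" if "x \<in> set xs" for x
    using orth[OF that] sub that v(1) by (auto simp: y_def)
  ultimately have "orthonormal_list m (xs @ [y])"
    using xs y by (auto simp: orthonormal_list_append) (simp add: orthonormal_list_def)
  then show ?thesis ..
qed

lemma orthonormal_list_extend:
  assumes "orthonormal_list m xs"
  shows "\<exists>ys. orthonormal_list m (xs @ ys) \<and> length (xs @ ys) = m"
  \<comment> \<open>The length bound joins the induction because the difference of natural numbers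
    is 0 for overlong lists as well.\<close>
  using orthonormal_list_length_le[OF assms] assms
proof (induction "m - length xs" arbitrary: xs)
  case 0
  then show ?case by (intro exI[of _ "[]"]) simp
next
  case (Suc d)
  then have "length xs < m" by simp
  then obtain y where y: "orthonormal_list m (xs @ [y])"
    using orthonormal_list_extend_one Suc.prems(2) by blast
  then obtain ys where "orthonormal_list m ((xs @ [y]) @ ys) \<and> length ((xs @ [y]) @ ys) = m"
    using Suc.hyps(1)[of "xs @ [y]"] Suc.hyps(2) \<open>length xs < m\<close> by fastforce
  then show ?case by (intro exI[of _ "y # ys"]) simp
qed

section \<open>Rechoosing left singular vectors\<close>

text \<open>Left singular vectors belonging to zero singular values are arbitrary, so they can be replaced
  by a completion of the others together with \<open>C\<close>, with the columns of \<open>C\<close> put last.\<close>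

lemma svd_left_orthogonal_complement:
  assumes svd: "is_svd m n X U S V" and C: "C \<in> carrier_mat m q" "orthonormal_cols C"
    and CX: "C\<^sup>T * X = 0\<^sub>m q n" and r: "r + q \<le> m"
  shows "\<exists>U'. is_svd m n X U' S V \<and> C\<^sup>T * first_cols r U' = 0\<^sub>m q r"
proof -
  note D = is_svdD[OF svd]
  \<comment> \<open>\<open>d\<close> counts the nonzero singular values; the alternative
    \<open>j = min m n\<close> keeps \<open>LEAST\<close> well defined when none vanishes.\<close>
  define d where "d = (LEAST j. j = min m n \<or> S $$ (j, j) = 0)"
  have d: "d = min m n \<or> S $$ (d, d) = 0"
    unfolding d_def by (rule LeastI[of _ "min m n"]) simp
  have dle: "d \<le> min m n" unfolding d_def by (rule Least_le) simp
  have nz: "S $$ (j, j) \<noteq> 0" if "j < d" for j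
    using not_less_Least[of j] that unfolding d_def by blast
  have zero: "S $$ (l, l) = 0" if "d \<le> l" "l < min m n" for l
    using D(7)[of l] D(8)[of d l] that d by auto
  define us where "us = take d (cols U)"
  have us: "length us = d" "\<And>j. j < d \<Longrightarrow> us ! j = col U j"
    using D dle by (auto simp: us_def)
  have "orthonormal_list m (us @ drop d (cols U))"
    using D by (simp add: us_def orthonormal_list_cols)
  then have "orthonormal_list m us" by (simp add: orthonormal_list_append)
  moreover have "c \<bullet> u = 0" if c: "c \<in> set (cols C)" and u: "u \<in> set us" for c u
  proof -
    obtain i where i: "i < q" "c = col C i"
      using c C by (auto simp: in_set_conv_nth)
    obtain j where j: "j < d" "u = col U j"
      using u us by (auto simp: in_set_conv_nth)
    have "(C\<^sup>T * U) $$ (i, j) = 0"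
      using C CX i j dle nz by (intro left_singular_vector_orthogonal[OF svd]) auto
    then show ?thesis using i j dle C D by simp
  qed
  ultimately have "orthonormal_list m (cols C @ us)"
    using C by (simp add: orthonormal_list_append orthonormal_list_cols)
  then obtain ys where ys: "orthonormal_list m ((cols C @ us) @ ys)" "length ((cols C @ us) @ ys) = m"
    using orthonormal_list_extend by blast
  define zs where "zs = us @ ys"
  have "orthonormal_list m (cols C @ zs)" using ys(1) by (simp add: zs_def)
  then have on: "orthonormal_list m (zs @ cols C)" by (simp only: orthonormal_list_append_commute)
  \<comment> \<open>\<open>zs\<close> has \<open>m - q\<close> members, which is at least
    \<open>r\<close>, so the first \<open>r\<close> columns of \<open>U'\<close> all come from
    \<open>zs\<close> and none from \<open>C\<close>.\<close>
  have lz: "length zs + q = m" using ys(2) C by (simp add: zs_def)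
  have sub: "set (zs @ cols C) \<subseteq> carrier_vec m" using on by (simp add: orthonormal_list_def)
  define U' where "U' = mat_of_cols m (zs @ cols C)"
  have U': "U' \<in> carrier_mat m m"
    using mat_of_cols_carrier(1)[of m "zs @ cols C"] lz C by (simp add: U'_def)
  have cU': "cols U' = zs @ cols C" unfolding U'_def using sub by (rule cols_mat_of_cols)
  have ortho: "orthonormal_cols U'"
    using on cU' U' by (simp flip: orthonormal_list_cols)
  have "col U' j = col U j" if "j < d" for j
  proof -
    have "col U' j = cols U' ! j" using that dle U' by simp
    then show ?thesis using that us by (simp add: cU' zs_def nth_append)
  qed
  then have same: "U' $$ (i, j) = U $$ (i, j)" if "i < m" "j < d" for i j
    using that dle U' D(1) index_col[of i U' j] index_col[of i U j] by simp
  \<comment> \<open>Columns before \<open>d\<close> are unchanged and later ones meet only zeros of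
    \<open>S\<close>, so the same \<open>S\<close> and \<open>V\<close> still decompose
    \<open>X\<close>.\<close>
  have "U' * S = U * S"
  proof (rule eq_matI)
    fix i j assume "i < dim_row (U * S)" "j < dim_col (U * S)"
    then have ij: "i < m" "j < n" using D by auto
    show "(U' * S) $$ (i, j) = (U * S) $$ (i, j)"
      using same[of i j] zero[of j] ij
      by (cases "j < d") (auto simp: mult_diagonal_index[OF D(1,2,6)] mult_diagonal_index[OF U' D(2,6)])
  qed (use D U' in auto)
  then have "is_svd m n X U' S V"
    using svd U' ortho unfolding is_svd_def by simp
  moreover have "C\<^sup>T * first_cols r U' = 0\<^sub>m q r"
  proof (rule eq_matI)
    fix i j assume "i < dim_row (0\<^sub>m q r)" "j < dim_col (0\<^sub>m q r)"
    then have ij: "i < q" "j < r" by auto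
    have "(C\<^sup>T * first_cols r U') $$ (i, j) = (C\<^sup>T * U') $$ (i, j)"
      using ij r U' C by (intro mult_first_cols_index) auto
    also have "\<dots> = col C i \<bullet> col U' j"
      using ij r U' C by simp
    also have "col U' j = cols U' ! j" using ij r U' by simp
    also have "\<dots> = zs ! j" using ij r lz by (simp add: cU' nth_append)
    also have "col C i \<bullet> zs ! j = 0"
      using \<open>orthonormal_list m (cols C @ zs)\<close> ij r lz C
      by (auto simp: orthonormal_list_append cols_def)
    finally show "(C\<^sup>T * first_cols r U') $$ (i, j) = 0\<^sub>m q r $$ (i, j)" using ij by simp
  qed (use U' C r first_cols_carrier[OF U', of r] in auto)
  ultimately show ?thesis by blast
qed

section \<open>Concatenated matrices and the residual of the gradient\<close>

lemma hconcat_carrier: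
  assumes "A \<in> carrier_mat m p" "B \<in> carrier_mat m k"
  shows "hconcat A B \<in> carrier_mat m (p + k)"
  using assms mat_of_cols_carrier(1)[of m "cols A @ cols B"] by (simp add: hconcat_def)

lemma cols_hconcat:
  assumes "A \<in> carrier_mat m p" "B \<in> carrier_mat m k"
  shows "cols (hconcat A B) = cols A @ cols B"
  unfolding hconcat_def using assms cols_dim[of A] cols_dim[of B]
  by (intro cols_mat_of_cols) auto

text \<open>Quantifying over sets of columns lets the condition for a concatenation split along a
  union.\<close>

lemma transpose_mult_eq_0_iff:
  fixes A Y :: "real mat"
  assumes "A \<in> carrier_mat m p" "Y \<in> carrier_mat m l"
  shows "A\<^sup>T * Y = 0\<^sub>m p l \<longleftrightarrow> (\<forall>a\<in>set (cols A). \<forall>y\<in>set (cols Y). a \<bullet> y = 0)"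
  using assms by (auto simp: mat_eq_iff cols_def)

lemma hconcat_mult_eq_0_iff:
  assumes "A \<in> carrier_mat m p" "B \<in> carrier_mat m k" "Y \<in> carrier_mat m l"
  shows "(hconcat A B)\<^sup>T * Y = 0\<^sub>m (p + k) l \<longleftrightarrow> A\<^sup>T * Y = 0\<^sub>m p l \<and> B\<^sup>T * Y = 0\<^sub>m k l"
  using transpose_mult_eq_0_iff[OF hconcat_carrier[OF assms(1,2)] assms(3)]
    transpose_mult_eq_0_iff[OF assms(1,3)] transpose_mult_eq_0_iff[OF assms(2,3)]
    cols_hconcat[OF assms(1,2)]
  by auto

lemma orthonormal_cols_hconcatD:
  assumes A: "A \<in> carrier_mat m p" and B: "B \<in> carrier_mat m k"
    and on: "orthonormal_cols (hconcat A B)"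
  shows "A\<^sup>T * A = 1\<^sub>m p" "B\<^sup>T * B = 1\<^sub>m k" "A\<^sup>T * B = 0\<^sub>m p k" "B\<^sup>T * A = 0\<^sub>m k p"
proof -
  have on': "orthonormal_list m (cols A @ cols B)"
    using on cols_hconcat[OF A B] by (simp flip: orthonormal_list_cols[OF hconcat_carrier[OF A B]])
  then have "orthonormal_cols A" "orthonormal_cols B"
    by (auto simp: orthonormal_list_append orthonormal_list_cols[OF A] orthonormal_list_cols[OF B])
  then show "A\<^sup>T * A = 1\<^sub>m p" "B\<^sup>T * B = 1\<^sub>m k"
    using A B by (auto simp: orthonormal_cols_def)
  show "A\<^sup>T * B = 0\<^sub>m p k"
    using on' by (simp add: transpose_mult_eq_0_iff[OF A B] orthonormal_list_append)
  show "B\<^sup>T * A = 0\<^sub>m k p"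
    using on' orthonormal_list_append_commute[of m "cols A" "cols B"]
    by (simp add: transpose_mult_eq_0_iff[OF B A] orthonormal_list_append)
qed

text \<open>With \<open>D\<close> taken as \<open>A\<close> or \<open>B\<close> in
  \<open>dist\<close>, one Gram block is the identity, whose term cancels
  \<open>D\<^sup>T * G\<close>, and the mixed block is zero.\<close>

lemma transpose_mult_residual:
  fixes A B G :: "real mat"
  assumes A: "A \<in> carrier_mat m p" and B: "B \<in> carrier_mat m k" and G: "G \<in> carrier_mat m n"
    and on: "orthonormal_cols (hconcat A B)"
    and X: "X = G - A * A\<^sup>T * G - B * B\<^sup>T * G"
  shows "(hconcat A B)\<^sup>T * X = 0\<^sub>m (p + k) n"
proof -
  note O = orthonormal_cols_hconcatD[OF A B on]
  have dist: "D\<^sup>T * X = D\<^sup>T * G - (D\<^sup>T * A) * (A\<^sup>T * G) - (D\<^sup>T * B) * (B\<^sup>T * G)"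
    if D: "D \<in> carrier_mat m q" for D q
  proof -
    have proj: "D\<^sup>T * (E * E\<^sup>T * G) = (D\<^sup>T * E) * (E\<^sup>T * G)" if E: "E \<in> carrier_mat m l" for E l
    proof -
      have "E * E\<^sup>T * G = E * (E\<^sup>T * G)" using E G by (intro assoc_mult_mat) auto
      moreover have "D\<^sup>T * (E * (E\<^sup>T * G)) = (D\<^sup>T * E) * (E\<^sup>T * G)"
        using D E G by (intro assoc_mult_mat[symmetric]) auto
      ultimately show ?thesis by simp
    qed
    have "D\<^sup>T * X = D\<^sup>T * (G - A * A\<^sup>T * G) - D\<^sup>T * (B * B\<^sup>T * G)"
      unfolding X using D A B G by (intro mult_minus_distrib_mat) (auto intro: minus_carrier_mat)
    also have "D\<^sup>T * (G - A * A\<^sup>T * G) = D\<^sup>T * G - D\<^sup>T * (A * A\<^sup>T * G)"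
      using D A G by (intro mult_minus_distrib_mat) auto
    finally show ?thesis by (simp only: proj[OF A] proj[OF B])
  qed
  have "X \<in> carrier_mat m n"
    unfolding X using A B G by (auto intro: minus_carrier_mat)
  moreover have "A\<^sup>T * X = 0\<^sub>m p n"
    unfolding dist[OF A] O using A B G by auto
  moreover have "B\<^sup>T * X = 0\<^sub>m k n"
    unfolding dist[OF B] O using A B G by auto
  ultimately show ?thesis using hconcat_mult_eq_0_iff[OF A B] by simp
qed

text \<open>Left singular vectors of singular value zero may point into the span of
  \<open>Wp\<close> and \<open>M\<close>, so the given \<open>U\<close> is used under a rank
  condition that keeps its first \<open>r\<close> singular values nonzero. The second part chooses a
  suitable decomposition instead; \<open>r + p + k <= d_in\<close> is the room any feasible matrix
  takes up, its columns being orthonormal together with those of \<open>Wp\<close> and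
  \<open>M\<close>.\<close>

theorem proposition2:
  fixes d_in d_out p k r :: nat
    and loss :: "real mat \<Rightarrow> real"
    and W G W_pre U_pre S_pre V_pre Wp M Ghat U S V :: "real mat"
  assumes "has_gradient_mat d_in d_out loss W G"
    and "is_svd d_in d_out W_pre U_pre S_pre V_pre"
    and "p \<le> d_in"
    and "Wp = first_cols p U_pre"
    and "M \<in> carrier_mat d_in k"
    and "orthonormal_cols (hconcat Wp M)"
    and "Ghat = G - Wp * Wp\<^sup>T * G - M * M\<^sup>T * G"
    and "r \<le> min d_in d_out"
    and "is_svd d_in d_out Ghat U S V"
  shows "(r \<le> vec_space.rank d_in Ghat \<longrightarrow>
            is_arg_min (projection_error G) (\<lambda>A. A \<in> feasible d_in r Wp M) (first_cols r U)) \<and>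
         (r + p + k \<le> d_in \<longrightarrow>
            (\<exists>U'. is_svd d_in d_out Ghat U' S V \<and>
               is_arg_min (projection_error G) (\<lambda>A. A \<in> feasible d_in r Wp M) (first_cols r U')))"
proof -
  have G: "G \<in> carrier_mat d_in d_out" using assms(1) by (simp add: has_gradient_mat_def)
  have Wp: "Wp \<in> carrier_mat d_in p"
    using is_svdD(1)[OF assms(2)] assms(3,4) by (simp add: first_cols_carrier)
  note M = assms(5) and svd = assms(9) and r = assms(8)
  define C where "C = hconcat Wp M"
  have C: "C \<in> carrier_mat d_in (p + k)" unfolding C_def using Wp M by (rule hconcat_carrier)
  have onC: "orthonormal_cols C" using assms(6) by (simp add: C_def)
  have CX: "C\<^sup>T * Ghat = 0\<^sub>m (p + k) d_out"
    unfolding C_def using Wp M G assms(6,7) by (rule transpose_mult_residual)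
  \<comment> \<open>With both constraints packed into \<open>C\<close>, each part only has to show
    that \<open>C\<^sup>T\<close> annihilates the leading columns.\<close>
  have min: "is_arg_min (projection_error G) (\<lambda>A. A \<in> feasible d_in r Wp M) (first_cols r U')"
    if svd': "is_svd d_in d_out Ghat U' S V" and "C\<^sup>T * first_cols r U' = 0\<^sub>m (p + k) r" for U'
  proof -
    have "first_cols r U' \<in> carrier_mat d_in r"
      using is_svdD(1)[OF svd'] r by (simp add: first_cols_carrier)
    then show ?thesis
      using that hconcat_mult_eq_0_iff[OF Wp M]
      by (intro first_cols_arg_min[OF G Wp M assms(7) svd' r]) (auto simp: C_def)
  qed
  have "is_arg_min (projection_error G) (\<lambda>A. A \<in> feasible d_in r Wp M) (first_cols r U)"
    if rank: "r \<le> vec_space.rank d_in Ghat"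
  proof (intro min[OF svd] eq_matI)
    note U = is_svdD(1)[OF svd]
    fix i j assume "i < dim_row (0\<^sub>m (p + k) r)" "j < dim_col (0\<^sub>m (p + k) r)"
    then have ij: "i < p + k" "j < r" by auto
    have "(C\<^sup>T * first_cols r U) $$ (i, j) = (C\<^sup>T * U) $$ (i, j)"
      using ij r U C by (intro mult_first_cols_index) auto
    also have "\<dots> = 0"
      using ij r C CX singular_value_nonzero[OF svd r rank]
      by (intro left_singular_vector_orthogonal[OF svd]) auto
    finally show "(C\<^sup>T * first_cols r U) $$ (i, j) = 0\<^sub>m (p + k) r $$ (i, j)" using ij by simp
  qed (use C r first_cols_carrier[OF is_svdD(1)[OF svd], of r] in auto)
  moreover have "\<exists>U'. is_svd d_in d_out Ghat U' S V \<and>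
      is_arg_min (projection_error G) (\<lambda>A. A \<in> feasible d_in r Wp M) (first_cols r U')"
    if "r + p + k \<le> d_in"
    using svd_left_orthogonal_complement[OF svd C onC CX, of r] min that by auto
  ultimately show ?thesis by blast
qed

end
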